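(* Let $n\in\mathbb{N}$. The expected number of lucky cars in a uniformly random weakly increasing parking function with $n$ cars is $\dfrac{3n}{n+2}$.
   Context: A weakly increasing parking function of length $n$ is a list $\alpha=(\alpha_1,\dots,\alpha_n)\in\{1,\dots,n\}^n$ with $\alpha_i\le i$ for all $i$ and $\alpha_1\le\cdots\le\alpha_n$. Classical parking protocol: cars $1,\dots,n$ arrive in order; car $i$ parks in spot $\alpha_i$ if it is unoccupied, otherwise in the first unoccupied spot to the right of $\alpha_i$. A car is lucky if it parks in its preferred spot $\alpha_i$. *)

theory Defs
  imports "HOL-Probability.Probability_Mass_Function"
begin

definition weakly_increasing_pf :: "nat \<Rightarrow> nat list set" where
  "weakly_increasing_pf n =
    {\<alpha>. length \<alpha> = n \<and> (\<forall>i<n. \<alpha> ! i \<in> {1..n}) \<and> (\<forall>i<n. \<alpha> ! i \<le> i + 1) \<and> sorted \<alpha>}"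

lemma finite_weakly_increasing_pf: "finite (weakly_increasing_pf n)"
proof (rule finite_subset)
  show "weakly_increasing_pf n \<subseteq> {\<alpha>. set \<alpha> \<subseteq> {1..n} \<and> length \<alpha> = n}"
    unfolding weakly_increasing_pf_def in_set_conv_nth subset_iff by blast
qed (simp add: finite_lists_length_eq)

lemma weakly_increasing_pf_nonempty: "weakly_increasing_pf n \<noteq> {}"
proof -
  have "replicate n 1 \<in> weakly_increasing_pf n"
    by (auto simp: weakly_increasing_pf_def)
  thus ?thesis by blast
qed

text \<open>The street has spots \<open>1, \<dots>, n\<close>. The result is \<open>None\<close> if the car leaves the street
  without parking, which never happens when the preferences form a parking function.\<close>

definition parking_spot :: "nat \<Rightarrow> nat set \<Rightarrow> nat \<Rightarrow> nat option" where
  "parking_spot n occupied a =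
    (if a \<notin> occupied then Some a
     else if \<exists>s. a < s \<and> s \<le> n \<and> s \<notin> occupied
       then Some (LEAST s. a < s \<and> s \<le> n \<and> s \<notin> occupied)
     else None)"

fun park_cars :: "nat \<Rightarrow> nat set \<Rightarrow> nat list \<Rightarrow> nat option list" where
  "park_cars n occupied [] = []"
| "park_cars n occupied (a # as) =
    (let s = parking_spot n occupied a
     in s # park_cars n (occupied \<union> set_option s) as)"

definition parking_outcome :: "nat list \<Rightarrow> nat option list" where
  "parking_outcome \<alpha> = park_cars (length \<alpha>) {} \<alpha>"

definition lucky_cars :: "nat list \<Rightarrow> nat set" where
  "lucky_cars \<alpha> = {i. i < length \<alpha> \<and> parking_outcome \<alpha> ! i = Some (\<alpha> ! i)}"

end

theory Submission
  imports Defs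
begin

text \<open>
  When a weakly increasing parking function parks, car \<open>i\<close> always finds exactly the spots
  \<open>1, \<dots>, i - 1\<close> taken, so it ends up in spot \<open>i\<close>, and it is lucky iff its preference is \<open>i\<close>
  itself. The expectation is therefore the average number of fixed points \<open>\<alpha>\<^sub>i = i\<close>.

  Let \<open>c n\<close> be the number of weakly increasing parking functions of length \<open>n\<close>. Duplicating the
  entry at a fixed point \<open>i\<close> of \<open>\<alpha>\<close> gives one of length \<open>n + 1\<close> whose last fixed point
  is \<open>i\<close>, because the entries after it have moved one place to the right. Deleting the last fixed
  point undoes this, so the pairs of a parking function and one of its fixed points
  correspond to the parking functions of length \<open>n + 1\<close> that do not end in the fixed point
  \<open>n + 1\<close> (lemma \<open>bij_betw_dup_entry\<close>). Those that do end in it number \<open>c n\<close>, so the total number of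
  fixed points is \<open>c (n + 1) - c n\<close>.

  Finally \<open>c n\<close> is the Catalan number \<open>(2 n choose n) / (n + 1)\<close> (lemma
  \<open>card_weakly_increasing_pf\<close>), obtained from the ballot numbers that
  count parking functions with bounded entries. Hence
  \<open>c (n + 1) / c n = (4 n + 2) / (n + 2)\<close>, and subtracting \<open>1\<close> leaves \<open>3 n / (n + 2)\<close>.
\<close>

section \<open>Lucky cars are fixed points\<close>

lemma weakly_increasing_pf_iff:
  "\<alpha> \<in> weakly_increasing_pf n \<longleftrightarrow>
     length \<alpha> = n \<and> (\<forall>i<n. 1 \<le> \<alpha> ! i \<and> \<alpha> ! i \<le> i + 1) \<and> sorted \<alpha>"
  unfolding weakly_increasing_pf_def by fastforce

lemma parking_spot_initial_segment:
  assumes "1 \<le> a" "a \<le> Suc m" "Suc m \<le> n"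
  shows "parking_spot n {1..m} a = Some (Suc m)"
proof (cases "a = Suc m")
  case True
  then show ?thesis by (simp add: parking_spot_def)
next
  case False
  have "(LEAST s. a < s \<and> s \<le> n \<and> s \<notin> {1..m}) = Suc m"
    by (rule Least_equality) (use assms False in auto)
  moreover have "\<exists>s. a < s \<and> s \<le> n \<and> s \<notin> {1..m}"
    using assms False by (intro exI[of _ "Suc m"]) auto
  ultimately show ?thesis
    using assms False by (auto simp: parking_spot_def)
qed

text \<open>No preference lies beyond the first free spot, so the street fills from the left without
  gaps.\<close>

lemma park_cars_initial_segment:
  assumes "\<forall>i<length as. 1 \<le> as ! i \<and> as ! i \<le> m + i + 1" "m + length as \<le> n"
  shows "park_cars n {1..m} as = map Some [Suc m..<Suc (m + length as)]"
  using assms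
proof (induction as arbitrary: m)
  case Nil
  then show ?case by simp
next
  case (Cons a as)
  have a: "1 \<le> a" "a \<le> Suc m" and n: "Suc m \<le> n"
    using Cons.prems by force+
  have "1 \<le> as ! i \<and> as ! i \<le> Suc m + i + 1" if "i < length as" for i
    using Cons.prems(1)[rule_format, of "Suc i"] that by simp
  then have "park_cars n {1..Suc m} as = map Some [Suc (Suc m)..<Suc (Suc m + length as)]"
    using Cons.prems(2) by (intro Cons.IH) auto
  moreover have "{1..m} \<union> {Suc m} = {1..Suc m}" by auto
  moreover have "[Suc m..<Suc (m + length (a # as))]
      = Suc m # [Suc (Suc m)..<Suc (Suc m + length as)]"
    by (simp add: upt_rec)
  ultimately show ?case
    using parking_spot_initial_segment[OF a n] by (simp add: Let_def)
qed

text \<open>Indices of lists start at \<open>0\<close> and spots at \<open>1\<close>, hence the successor.\<close>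

lemma lucky_cars_eq_fixed_points:
  assumes "\<alpha> \<in> weakly_increasing_pf n"
  shows "lucky_cars \<alpha> = {i. i < n \<and> \<alpha> ! i = Suc i}"
proof -
  have "park_cars (length \<alpha>) {1..0} \<alpha> = map Some [Suc 0..<Suc (0 + length \<alpha>)]"
    using assms by (intro park_cars_initial_segment) (auto simp: weakly_increasing_pf_iff)
  then have "parking_outcome \<alpha> = map Some [Suc 0..<Suc n]"
    using assms by (simp add: parking_outcome_def weakly_increasing_pf_iff)
  then show ?thesis
    using assms by (auto simp: lucky_cars_def weakly_increasing_pf_iff simp del: upt_Suc)
qed

section \<open>Duplicating a fixed point\<close>

lemma snoc_in_weakly_increasing_pf_iff:
  "xs @ [a] \<in> weakly_increasing_pf (Suc n) \<longleftrightarrow>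
     xs \<in> weakly_increasing_pf n \<and> 1 \<le> a \<and> a \<le> Suc n \<and> (\<forall>x\<in>set xs. x \<le> a)"
  by (auto simp: weakly_increasing_pf_iff sorted_append nth_append less_Suc_eq all_conj_distrib)

lemma weakly_increasing_pf_SucE:
  assumes "\<beta> \<in> weakly_increasing_pf (Suc n)"
  obtains xs a where "\<beta> = xs @ [a]" "length xs = n"
  using assms by (cases \<beta> rule: rev_cases) (auto simp: weakly_increasing_pf_iff)

lemma weakly_increasing_pf_le:
  assumes "\<alpha> \<in> weakly_increasing_pf n" "x \<in> set \<alpha>"
  shows "x \<le> n"
  using assms by (fastforce simp: weakly_increasing_pf_iff in_set_conv_nth)

definition dup_entry :: "nat list \<Rightarrow> nat \<Rightarrow> nat list" where
  "dup_entry \<alpha> i = take (Suc i) \<alpha> @ drop i \<alpha>"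

lemma nth_dup_entry:
  assumes "i < length \<alpha>" "j \<le> length \<alpha>"
  shows "dup_entry \<alpha> i ! j = (if j \<le> i then \<alpha> ! j else \<alpha> ! (j - 1))"
proof (cases "j \<le> i")
  case False
  then have "i + (j - Suc i) = j - 1" by simp
  with False show ?thesis using assms by (simp add: dup_entry_def nth_append)
qed (use assms in \<open>simp add: dup_entry_def nth_append\<close>)

lemma length_dup_entry: "i < length \<alpha> \<Longrightarrow> length (dup_entry \<alpha> i) = Suc (length \<alpha>)"
  by (simp add: dup_entry_def)

lemma dup_entry_in_weakly_increasing_pf:
  assumes \<alpha>: "\<alpha> \<in> weakly_increasing_pf n" and i: "i < n"
  shows "dup_entry \<alpha> i \<in> weakly_increasing_pf (Suc n)"
proof -
  have bd: "1 \<le> \<alpha> ! j \<and> \<alpha> ! j \<le> j + 1" if "j < n" for j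
    using \<alpha> that by (auto simp: weakly_increasing_pf_iff)
  have len: "length \<alpha> = n" using \<alpha> by (simp add: weakly_increasing_pf_iff)
  have mono: "\<alpha> ! j \<le> \<alpha> ! k" if "j \<le> k" "k < n" for j k
    using \<alpha> that by (auto simp: weakly_increasing_pf_iff sorted_iff_nth_mono)
  have "sorted (dup_entry \<alpha> i)"
    unfolding sorted_iff_nth_mono
    using i len by (auto simp: length_dup_entry nth_dup_entry intro!: mono)
  moreover have "1 \<le> dup_entry \<alpha> i ! j \<and> dup_entry \<alpha> i ! j \<le> j + 1" if "j < Suc n" for j
  proof (cases "j \<le> i")
    case True
    then show ?thesis using bd[of j] i len by (simp add: nth_dup_entry)
  next
    case False
    then have "j - 1 < n" using that by linarith
    then show ?thesis using False bd[of "j - 1"] i len that by (simp add: nth_dup_entry)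
  qed
  ultimately show ?thesis
    using i len by (auto simp: weakly_increasing_pf_iff length_dup_entry)
qed

text \<open>An entry that moves to the right by one place respects its old bound and so lies strictly
  below its new one. This is why the duplicated fixed point can be read off from the result.\<close>

lemma dup_entry_last_fixed_point:
  assumes \<alpha>: "\<alpha> \<in> weakly_increasing_pf n" and i: "i < n" "\<alpha> ! i = Suc i"
  shows "dup_entry \<alpha> i ! i = Suc i"
    and "\<And>j. i < j \<Longrightarrow> j \<le> n \<Longrightarrow> dup_entry \<alpha> i ! j \<noteq> Suc j"
proof -
  have len: "length \<alpha> = n" using \<alpha> by (simp add: weakly_increasing_pf_iff)
  show "dup_entry \<alpha> i ! i = Suc i" using i len by (simp add: nth_dup_entry)
  fix j assume j: "i < j" "j \<le> n"
  then have "\<alpha> ! (j - 1) \<le> (j - 1) + 1"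
    using \<alpha> by (auto simp: weakly_increasing_pf_iff simp del: Suc_pred)
  then show "dup_entry \<alpha> i ! j \<noteq> Suc j" using i j len by (simp add: nth_dup_entry)
qed

lemma dup_entry_inject:
  assumes "dup_entry \<alpha> i = dup_entry \<alpha>' i" "i < length \<alpha>" "length \<alpha>' = length \<alpha>"
  shows "\<alpha> = \<alpha>'"
proof -
  have "take (Suc i) \<alpha> = take (Suc i) \<alpha>'" "drop i \<alpha> = drop i \<alpha>'"
    using assms by (auto simp: dup_entry_def append_eq_append_conv)
  then have "take i \<alpha> = take i \<alpha>'"
    by (metis take_take min.absorb1 lessI less_imp_le)
  with \<open>drop i \<alpha> = drop i \<alpha>'\<close> show ?thesis by (metis append_take_drop_id)
qed

text \<open>Conversely, deleting a last fixed point before the end leaves a parking function: the entries after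
  it lie strictly below their bounds, so they can move one place to the left. The entry that moves into
  its place is both at least and at most the deleted one, so it becomes a fixed point itself.\<close>

lemma dup_entry_surj:
  assumes \<beta>: "\<beta> \<in> weakly_increasing_pf (Suc n)" and i: "i < n" "\<beta> ! i = Suc i"
    and last: "\<And>j. i < j \<Longrightarrow> j \<le> n \<Longrightarrow> \<beta> ! j \<noteq> Suc j"
  obtains \<alpha> where "\<alpha> \<in> weakly_increasing_pf n" "\<alpha> ! i = Suc i" "dup_entry \<alpha> i = \<beta>"
proof
  define \<alpha> where "\<alpha> = take i \<beta> @ drop (Suc i) \<beta>"
  have len: "length \<beta> = Suc n"
    using \<beta> by (simp add: weakly_increasing_pf_iff)
  have bd: "1 \<le> \<beta> ! j \<and> \<beta> ! j \<le> Suc j" if "j \<le> n" for j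
    using \<beta> that by (auto simp: weakly_increasing_pf_iff)
  have mono: "\<beta> ! j \<le> \<beta> ! k" if "j \<le> k" "k \<le> n" for j k
    using \<beta> that by (auto simp: weakly_increasing_pf_iff sorted_iff_nth_mono)
  have below: "\<beta> ! j \<le> j" if "i < j" "j \<le> n" for j
    using bd[of j] last[of j] that by linarith
  have len\<alpha>: "length \<alpha> = n" using len i by (simp add: \<alpha>_def)
  have nth\<alpha>: "\<alpha> ! j = (if j < i then \<beta> ! j else \<beta> ! Suc j)" if "j < n" for j
    using len i that by (auto simp: \<alpha>_def nth_append)
  have "sorted \<alpha>"
    unfolding sorted_iff_nth_mono using len\<alpha> by (auto simp: nth\<alpha> intro!: mono)
  moreover have "1 \<le> \<alpha> ! j \<and> \<alpha> ! j \<le> j + 1" if "j < n" for j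
    using bd[of j] bd[of "Suc j"] below[of "Suc j"] that by (auto simp: nth\<alpha>)
  ultimately show "\<alpha> \<in> weakly_increasing_pf n"
    using len\<alpha> by (simp add: weakly_increasing_pf_iff)
  have next_entry: "\<beta> ! Suc i = Suc i"
    using mono[of i "Suc i"] below[of "Suc i"] i by simp
  then show "\<alpha> ! i = Suc i" using i by (simp add: nth\<alpha>)
  show "dup_entry \<alpha> i = \<beta>"
  proof (rule nth_equalityI)
    show "length (dup_entry \<alpha> i) = length \<beta>"
      using i len len\<alpha> by (simp add: length_dup_entry)
    fix j assume "j < length (dup_entry \<alpha> i)"
    then have j: "j \<le> n" using i len\<alpha> by (simp add: length_dup_entry)
    consider "j < i" | "j = i" | "i < j" by linarith
    then show "dup_entry \<alpha> i ! j = \<beta> ! j"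
    proof cases
      case 2
      then show ?thesis using i len\<alpha> next_entry by (simp add: nth_dup_entry nth\<alpha>)
    qed (use i j len\<alpha> in \<open>auto simp: nth_dup_entry nth\<alpha>\<close>)
  qed
qed

lemma bij_betw_dup_entry:
  "bij_betw (\<lambda>(\<alpha>, i). dup_entry \<alpha> i)
     (SIGMA \<alpha>:weakly_increasing_pf n. {i. i < n \<and> \<alpha> ! i = Suc i})
     {\<beta> \<in> weakly_increasing_pf (Suc n). \<beta> ! n \<noteq> Suc n}"
    (is "bij_betw ?f ?A ?B")
  unfolding bij_betw_def
proof
  show "inj_on ?f ?A"
  proof (rule inj_onI, clarify)
    fix \<alpha> \<alpha>' i i'
    assume \<alpha>: "\<alpha> \<in> weakly_increasing_pf n" "i < n" "\<alpha> ! i = Suc i"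
      and \<alpha>': "\<alpha>' \<in> weakly_increasing_pf n" "i' < n" "\<alpha>' ! i' = Suc i'"
      and eq: "dup_entry \<alpha> i = dup_entry \<alpha>' i'"
    note fixed = dup_entry_last_fixed_point[OF \<alpha>] dup_entry_last_fixed_point[OF \<alpha>']
    have "i = i'"
    proof (rule ccontr)
      assume "i \<noteq> i'"
      then consider "i < i'" | "i' < i" by linarith
      then show False
        using fixed eq \<alpha>(2) \<alpha>'(2) by cases (metis less_imp_le)+
    qed
    with eq \<alpha> \<alpha>' show "\<alpha> = \<alpha>' \<and> i = i'"
      by (auto simp: weakly_increasing_pf_iff intro!: dup_entry_inject[of \<alpha> i \<alpha>'])
  qed
  show "?f ` ?A = ?B"
  proof
    show "?f ` ?A \<subseteq> ?B"
      using dup_entry_in_weakly_increasing_pf dup_entry_last_fixed_point(2) by fastforce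
    show "?B \<subseteq> ?f ` ?A"
    proof
      fix \<beta> assume "\<beta> \<in> ?B"
      then have \<beta>: "\<beta> \<in> weakly_increasing_pf (Suc n)" "\<beta> ! n \<noteq> Suc n" by auto
      define F where "F = {i. i \<le> n \<and> \<beta> ! i = Suc i}"
      define i where "i = Max F"
      have "finite F" by (simp add: F_def)
      \<comment> \<open>The first entry is always a fixed point, so there is a last one.\<close>
      have "1 \<le> \<beta> ! 0" "\<beta> ! 0 \<le> 1"
        using \<beta>(1) by (auto simp: weakly_increasing_pf_iff)
      then have "0 \<in> F" by (simp add: F_def)
      then have "i \<in> F" unfolding i_def using \<open>finite F\<close> by (intro Max_in) auto
      have "\<beta> ! j \<noteq> Suc j" if "i < j" "j \<le> n" for j
      proof
        assume "\<beta> ! j = Suc j"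
        then have "j \<in> F" using that by (simp add: F_def)
        then have "j \<le> i" unfolding i_def using \<open>finite F\<close> by (rule Max_ge[rotated])
        with that show False by simp
      qed
      moreover have "i < n" "\<beta> ! i = Suc i"
        using \<open>i \<in> F\<close> \<beta>(2) by (auto simp: F_def le_less)
      ultimately obtain \<alpha>
        where "\<alpha> \<in> weakly_increasing_pf n" "\<alpha> ! i = Suc i" "dup_entry \<alpha> i = \<beta>"
        using dup_entry_surj[OF \<beta>(1)] by metis
      with \<open>i < n\<close> show "\<beta> \<in> ?f ` ?A" by (force intro: rev_image_eqI[of "(\<alpha>, i)"])
    qed
  qed
qed

lemma card_pf_ending_in_fixed_point:
  "card {\<beta> \<in> weakly_increasing_pf (Suc n). \<beta> ! n = Suc n} = card (weakly_increasing_pf n)"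
proof -
  have "{\<beta> \<in> weakly_increasing_pf (Suc n). \<beta> ! n = Suc n}
      = (\<lambda>xs. xs @ [Suc n]) ` weakly_increasing_pf n" (is "?L = ?R")
  proof
    show "?L \<subseteq> ?R"
    proof
      fix \<beta> assume \<beta>: "\<beta> \<in> ?L"
      then obtain xs a where "\<beta> = xs @ [a]" "length xs = n"
        by (auto elim: weakly_increasing_pf_SucE)
      with \<beta> show "\<beta> \<in> ?R" by (auto simp: snoc_in_weakly_increasing_pf_iff)
    qed
    have "length xs = n \<and> (\<forall>x\<in>set xs. x \<le> Suc n)" if "xs \<in> weakly_increasing_pf n" for xs
      using that weakly_increasing_pf_le[OF that]
      by (auto simp: weakly_increasing_pf_iff intro: le_SucI)
    then show "?R \<subseteq> ?L"
      by (auto simp: snoc_in_weakly_increasing_pf_iff nth_append)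
  qed
  then show ?thesis by (simp add: card_image inj_on_def)
qed

lemma sum_card_lucky_cars:
  "(\<Sum>\<alpha>\<in>weakly_increasing_pf n. card (lucky_cars \<alpha>)) + card (weakly_increasing_pf n)
     = card (weakly_increasing_pf (Suc n))"
proof -
  let ?W = "weakly_increasing_pf (Suc n)"
  have "(\<Sum>\<alpha>\<in>weakly_increasing_pf n. card (lucky_cars \<alpha>))
      = (\<Sum>\<alpha>\<in>weakly_increasing_pf n. card {i. i < n \<and> \<alpha> ! i = Suc i})"
    by (simp add: lucky_cars_eq_fixed_points)
  also have "\<dots> = card (SIGMA \<alpha>:weakly_increasing_pf n. {i. i < n \<and> \<alpha> ! i = Suc i})"
    by (simp add: finite_weakly_increasing_pf)
  also have "\<dots> = card {\<beta> \<in> ?W. \<beta> ! n \<noteq> Suc n}"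
    by (rule bij_betw_same_card[OF bij_betw_dup_entry])
  finally have "(\<Sum>\<alpha>\<in>weakly_increasing_pf n. card (lucky_cars \<alpha>)) + card (weakly_increasing_pf n)
      = card {\<beta> \<in> ?W. \<beta> ! n \<noteq> Suc n} + card {\<beta> \<in> ?W. \<beta> ! n = Suc n}"
    by (simp add: card_pf_ending_in_fixed_point)
  also have "\<dots> = card ({\<beta> \<in> ?W. \<beta> ! n \<noteq> Suc n} \<union> {\<beta> \<in> ?W. \<beta> ! n = Suc n})"
    by (rule card_Un_disjoint[symmetric]) (auto simp: finite_weakly_increasing_pf)
  also have "{\<beta> \<in> ?W. \<beta> ! n \<noteq> Suc n} \<union> {\<beta> \<in> ?W. \<beta> ! n = Suc n} = ?W" by auto
  finally show ?thesis .
qed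

section \<open>Ballot numbers and the Catalan count\<close>

definition bounded_pf :: "nat \<Rightarrow> nat \<Rightarrow> nat list set" where
  "bounded_pf n k = {\<alpha> \<in> weakly_increasing_pf n. \<forall>x\<in>set \<alpha>. x \<le> k}"

lemma finite_bounded_pf: "finite (bounded_pf n k)"
  by (simp add: bounded_pf_def finite_weakly_increasing_pf)

lemma bounded_pf_0_left: "bounded_pf 0 k = {[]}"
  by (auto simp: bounded_pf_def weakly_increasing_pf_iff)

lemma bounded_pf_Suc_0: "bounded_pf (Suc n) 0 = {}"
proof -
  have False if "\<alpha> \<in> bounded_pf (Suc n) 0" for \<alpha>
  proof -
    from that have \<alpha>: "\<alpha> \<in> weakly_increasing_pf (Suc n)" "\<forall>x\<in>set \<alpha>. x \<le> 0"
      by (auto simp: bounded_pf_def)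
    then have "1 \<le> \<alpha> ! 0" "\<alpha> ! 0 \<in> set \<alpha>"
      by (auto simp: weakly_increasing_pf_iff)
    with \<alpha>(2) show False by force
  qed
  then show ?thesis by blast
qed

lemma bounded_pf_eq:
  assumes "n \<le> k"
  shows "bounded_pf n k = weakly_increasing_pf n"
  using assms by (auto simp: bounded_pf_def dest: weakly_increasing_pf_le)

text \<open>The recursion of the ballot numbers: either the last entry is below the bound, or it equals
  the bound and then the entries before it are only subject to that same bound.\<close>

lemma card_bounded_pf_Suc_Suc:
  assumes "k \<le> n"
  shows "card (bounded_pf (Suc n) (Suc k)) = card (bounded_pf (Suc n) k) + card (bounded_pf n (Suc k))"
proof -
  have "bounded_pf (Suc n) (Suc k)
      = bounded_pf (Suc n) k \<union> (\<lambda>xs. xs @ [Suc k]) ` bounded_pf n (Suc k)" (is "?L = ?R")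
  proof
    show "?L \<subseteq> ?R"
    proof
      fix \<beta> assume \<beta>: "\<beta> \<in> ?L"
      then obtain xs a where xs: "\<beta> = xs @ [a]"
        by (auto simp: bounded_pf_def elim: weakly_increasing_pf_SucE)
      show "\<beta> \<in> ?R"
        using \<beta> unfolding xs
        by (cases "a = Suc k")
          (fastforce simp: bounded_pf_def snoc_in_weakly_increasing_pf_iff)+
    qed
    show "?R \<subseteq> ?L"
      using assms by (fastforce simp: bounded_pf_def snoc_in_weakly_increasing_pf_iff)
  qed
  moreover have "bounded_pf (Suc n) k \<inter> (\<lambda>xs. xs @ [Suc k]) ` bounded_pf n (Suc k) = {}"
    by (auto simp: bounded_pf_def)
  ultimately show ?thesis
    by (simp add: card_Un_disjoint finite_bounded_pf card_image inj_on_def)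
qed

text \<open>This is the ballot recursion for the closed form. By Pascal's rule all three binomials
  are combinations of two neighbours in row \<open>n + k + 1\<close>, whose ratio is \<open>(n + 1) / (k + 1)\<close>.\<close>

lemma ballot_identity:
  fixes n k :: nat
  shows "(real n + 1 - real k) / (real n + 2) * real ((Suc n + Suc k) choose Suc k)
    = (real n + 2 - real k) / (real n + 2) * real ((Suc n + k) choose k)
      + (real n - real k) / (real n + 1) * real ((n + Suc k) choose Suc k)"
proof -
  define A where "A = real ((Suc n + k) choose k)"
  define B where "B = real ((Suc n + k) choose Suc k)"
  have "Suc k * ((Suc n + k) choose Suc k) = Suc n * ((Suc n + k) choose k)"
    using Suc_times_binomial_add[of k n] by (simp add: add.commute del: binomial_Suc_Suc mult_Suc)
  then have "(real k + 1) * B = (real n + 1) * A"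
    unfolding A_def B_def by (metis of_nat_mult of_nat_Suc add.commute)
  moreover have "real ((Suc n + Suc k) choose Suc k) = A + B"
    by (simp add: A_def B_def)
  moreover have "real ((n + Suc k) choose Suc k) = B"
    by (simp add: B_def)
  ultimately show ?thesis
    unfolding A_def[symmetric]
    by (simp add: divide_simps) algebra
qed

text \<open>The binomial counts all lattice paths with \<open>n\<close> steps to the right and \<open>k\<close> steps up, which lead
  from the smallest preference \<open>1\<close> to the bound \<open>Suc k\<close>. The factor is the fraction of them
  that stays weakly below the diagonal, as in the ballot theorem.\<close>

lemma card_bounded_pf:
  "k \<le> n \<Longrightarrow> real (card (bounded_pf n (Suc k)))
     = (real n + 1 - real k) / (real n + 1) * real ((n + k) choose k)"
proof (induction n arbitrary: k)
  case 0
  then show ?case by (simp add: bounded_pf_0_left)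
next
  case (Suc n)
  note row = Suc.IH
  from \<open>k \<le> Suc n\<close> show ?case
  proof (induction k)
    case 0
    then show ?case
      using row[of 0] by (simp add: card_bounded_pf_Suc_Suc bounded_pf_Suc_0)
  next
    case (Suc k)
    have IH: "real (card (bounded_pf (Suc n) (Suc k)))
        = (real n + 2 - real k) / (real n + 2) * real ((Suc n + k) choose k)"
      using Suc by (simp add: add.commute add.left_commute)
    have "real (card (bounded_pf (Suc n) (Suc (Suc k))))
        = (real n + 1 - real k) / (real n + 2) * real ((Suc n + Suc k) choose Suc k)"
    proof (cases "k = n")
      case True
      \<comment> \<open>On the diagonal the bound cannot be attained any more, and the
        second summand of the closed form vanishes.\<close>
      then have "bounded_pf (Suc n) (Suc (Suc k)) = bounded_pf (Suc n) (Suc k)"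
        by (simp add: bounded_pf_eq)
      with True IH show ?thesis by (simp add: ballot_identity[of n n, simplified])
    next
      case False
      then have "real (card (bounded_pf (Suc n) (Suc (Suc k))))
          = real (card (bounded_pf (Suc n) (Suc k))) + real (card (bounded_pf n (Suc (Suc k))))"
        using Suc.prems by (simp add: card_bounded_pf_Suc_Suc)
      also have "real (card (bounded_pf n (Suc (Suc k))))
          = (real n - real k) / (real n + 1) * real ((n + Suc k) choose Suc k)"
        using row[of "Suc k"] False Suc.prems by simp
      finally show ?thesis using IH ballot_identity[of n k] by simp
    qed
    then show ?case by (simp add: add.commute)
  qed
qed

lemma card_weakly_increasing_pf:
  "real (card (weakly_increasing_pf n)) = real ((2 * n) choose n) / (real n + 1)"
  using card_bounded_pf[of n n] by (simp add: bounded_pf_eq mult_2)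

lemma card_weakly_increasing_pf_Suc:
  "(real n + 2) * real (card (weakly_increasing_pf (Suc n)))
     = (4 * real n + 2) * real (card (weakly_increasing_pf n))"
proof -
  define A where "A = real ((2 * n) choose n)"
  define B where "B = real (Suc (2 * n) choose n)"
  \<comment> \<open>The central binomial of row \<open>2 n + 2\<close> is twice the entry \<open>B\<close> of the odd row above it.\<close>
  have "real ((2 * Suc n) choose Suc n) = 2 * B"
    using binomial_symmetric[of n "Suc (2 * n)"] by (simp add: B_def)
  moreover have "Suc n * (Suc (2 * n) choose n) = Suc (2 * n) * ((2 * n) choose n)"
    using binomial_absorb_comp[of "Suc (2 * n)" n] by simp
  then have "(real n + 1) * B = (2 * real n + 1) * A"
    unfolding A_def B_def
    by (metis of_nat_mult of_nat_Suc add.commute of_nat_numeral)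
  ultimately show ?thesis
    unfolding card_weakly_increasing_pf A_def[symmetric]
    by (simp add: divide_simps) algebra
qed

section \<open>The expectation\<close>

theorem corollary2p9:
  fixes n :: nat
  shows "measure_pmf.expectation (pmf_of_set (weakly_increasing_pf n))
           (\<lambda>\<alpha>. real (card (lucky_cars \<alpha>))) = 3 * real n / (real n + 2)"
proof -
  define c where "c m = real (card (weakly_increasing_pf m))" for m
  have "c n > 0"
    by (simp add: c_def card_gt_0_iff finite_weakly_increasing_pf weakly_increasing_pf_nonempty)
  have "measure_pmf.expectation (pmf_of_set (weakly_increasing_pf n))
           (\<lambda>\<alpha>. real (card (lucky_cars \<alpha>)))
      = real (\<Sum>\<alpha>\<in>weakly_increasing_pf n. card (lucky_cars \<alpha>)) / c n"
    by (simp add: integral_pmf_of_set weakly_increasing_pf_nonempty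
        finite_weakly_increasing_pf c_def)
  also have "real (\<Sum>\<alpha>\<in>weakly_increasing_pf n. card (lucky_cars \<alpha>)) = c (Suc n) - c n"
    unfolding c_def sum_card_lucky_cars[of n, symmetric] by simp
  also have "(c (Suc n) - c n) / c n = 3 * real n / (real n + 2)"
    using card_weakly_increasing_pf_Suc[of n, folded c_def] \<open>c n > 0\<close>
    by (simp add: divide_simps) (simp add: algebra_simps)
  finally show ?thesis .
qed

end
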